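(* Let $G$ be a finite undirected graph (multiple edges and loops allowed), $v\in V(G)$, and $a\in\mathrm{Tisg}(G,v)$. Let $\langle a\rangle$ (the ideal generated by $a$) be the set of all $\varphi\in\mathrm{Tisg}(G,v)$, $\varphi:H\to K$, where $H$ and $K$ are connected induced subgraphs of $G$ containing $v$ and isomorphic to a connected induced subgraph of the domain of $a$ containing $v$. Then $\langle a\rangle$ is an ideal of $\mathrm{Tisg}(G,v)$ and is the minimal such ideal containing $a$.
   Context: Graphs are finite and undirected and may have multiple edges and loops. For $X\subseteq V(G)$, $G[X]$ is the subgraph of $G$ induced by $X$. A $v$-rooted tree induced subgraph of $G$ is a subgraph $H=G[V(T)]$ for some tree $T$ in $G$ rooted at $v$ (equivalently, a connected induced subgraph containing $v$). $\mathrm{Tisg}(G,v)$ is the set of all graph isomorphisms $\varphi:H\to J$ (bijections on vertices and on edges preserving incidence) with $H,J$ $v$-rooted tree induced subgraphs of $G$ and $\varphi(v)=v$. For $\varphi,\psi\in\mathrm{Tisg}(G,v)$, let $C_{\psi\circ\varphi}$ be the subgraph of $G$ induced by the set of all vertices $u$ for which there is a path from $v$ to $u$ contained in both $\mathrm{Im}(\varphi)$ and $\mathrm{Dom}(\psi)$; the product $\psi\circ\varphi:\varphi^{-1}(C_{\psi\circ\varphi})\to\psi(C_{\psi\circ\varphi})$ is the restriction of "apply $\varphi$, then $\psi$" to $\varphi^{-1}(C_{\psi\circ\varphi})$. With this product $\mathrm{Tisg}(G,v)$ is an inverse semigroup. An ideal of a semigroup $S$ is a subset $I\subseteq S$ with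 $SI\subseteq I$ and $IS\subseteq I$.
   Formalization: "Isomorphic to a connected induced subgraph of the domain of a containing v" is taken to mean by an isomorphism fixing v; with unrooted isomorphism minimality fails (path d-v-b-c, a = identity on {d,v,b}, and the identity on {v,b,c}). *)

theory Defs imports Main begin

record ('v, 'e) multigraph =
  verts :: "'v set"
  edges :: "'e set"
  ends :: "'e \<Rightarrow> 'v set"

text \<open>Each edge is sent to its set of end vertices: two vertices, or a single one for a loop.
  Distinct edges may have the same ends.\<close>

definition finite_multigraph :: "('v, 'e) multigraph \<Rightarrow> bool" where
  "finite_multigraph G \<longleftrightarrow> finite (verts G) \<and> finite (edges G) \<and>
     (\<forall>e\<in>edges G. \<exists>x\<in>verts G. \<exists>y\<in>verts G. ends G e = {x, y})"

definition subgraph :: "('v, 'e) multigraph \<Rightarrow> ('v, 'e) multigraph \<Rightarrow> bool" where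
  "subgraph H G \<longleftrightarrow> finite_multigraph H \<and> verts H \<subseteq> verts G \<and> edges H \<subseteq> edges G \<and>
     (\<forall>e\<in>edges H. ends H e = ends G e)"

text \<open>Only used for \<open>X \<subseteq> verts G\<close>.\<close>

definition induced :: "('v, 'e) multigraph \<Rightarrow> 'v set \<Rightarrow> ('v, 'e) multigraph" where
  "induced G X = \<lparr>verts = X, edges = {e \<in> edges G. ends G e \<subseteq> X}, ends = ends G\<rparr>"

text \<open>A walk from \<open>x\<close> to \<open>y\<close> is the list of its steps \<open>(e, z)\<close>: follow the edge \<open>e\<close> to the
  vertex \<open>z\<close>.\<close>

fun walk :: "('v, 'e) multigraph \<Rightarrow> 'v \<Rightarrow> ('e \<times> 'v) list \<Rightarrow> 'v \<Rightarrow> bool" where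
  "walk G x [] y \<longleftrightarrow> x \<in> verts G \<and> x = y"
| "walk G x ((e, z) # p) y \<longleftrightarrow>
     x \<in> verts G \<and> e \<in> edges G \<and> ends G e = {x, z} \<and> walk G z p y"

definition path :: "('v, 'e) multigraph \<Rightarrow> 'v \<Rightarrow> ('e \<times> 'v) list \<Rightarrow> 'v \<Rightarrow> bool" where
  "path G x p y \<longleftrightarrow> walk G x p y \<and> distinct (x # map snd p)"

text \<open>A loop is a cycle of length 1 and two parallel edges form a cycle of length 2;
  distinctness of the edges excludes going back and forth along one edge.\<close>

definition cycle :: "('v, 'e) multigraph \<Rightarrow> 'v \<Rightarrow> ('e \<times> 'v) list \<Rightarrow> bool" where
  "cycle G x p \<longleftrightarrow> walk G x p x \<and> p \<noteq> [] \<and> distinct (map fst p) \<and> distinct (map snd p)"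

definition connected :: "('v, 'e) multigraph \<Rightarrow> bool" where
  "connected G \<longleftrightarrow> verts G \<noteq> {} \<and> (\<forall>x\<in>verts G. \<forall>y\<in>verts G. \<exists>p. path G x p y)"

definition tree :: "('v, 'e) multigraph \<Rightarrow> bool" where
  "tree T \<longleftrightarrow> connected T \<and> \<not> (\<exists>x p. cycle T x p)"

definition rooted_tree_induced ::
    "('v, 'e) multigraph \<Rightarrow> 'v \<Rightarrow> ('v, 'e) multigraph \<Rightarrow> bool" where
  "rooted_tree_induced G v H \<longleftrightarrow>
     (\<exists>T. subgraph T G \<and> tree T \<and> v \<in> verts T \<and> H = induced G (verts T))"

definition rooted_connected_induced ::
    "('v, 'e) multigraph \<Rightarrow> 'v \<Rightarrow> ('v, 'e) multigraph \<Rightarrow> bool" where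
  "rooted_connected_induced G v H \<longleftrightarrow>
     (\<exists>X \<subseteq> verts G. v \<in> X \<and> H = induced G X \<and> connected H)"

text \<open>Isomorphisms between subgraphs are pairs of partial maps on vertices and edges, so that
  their domains and images are determined by the maps and equality is the intended one.\<close>

record ('v, 'e) graph_pmap =
  vmap :: "'v \<rightharpoonup> 'v"
  emap :: "'e \<rightharpoonup> 'e"

definition graph_iso ::
    "('v, 'e) multigraph \<Rightarrow> ('v, 'e) multigraph \<Rightarrow> ('v, 'e) graph_pmap \<Rightarrow> bool" where
  "graph_iso H J \<phi> \<longleftrightarrow>
     dom (vmap \<phi>) = verts H \<and> ran (vmap \<phi>) = verts J \<and> inj_on (vmap \<phi>) (verts H) \<and>
     dom (emap \<phi>) = edges H \<and> ran (emap \<phi>) = edges J \<and> inj_on (emap \<phi>) (edges H) \<and>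
     (\<forall>x\<in>verts H. \<forall>e\<in>edges H.
        x \<in> ends H e \<longleftrightarrow> the (vmap \<phi> x) \<in> ends J (the (emap \<phi> e)))"

definition rooted_iso ::
    "'v \<Rightarrow> ('v, 'e) multigraph \<Rightarrow> ('v, 'e) multigraph \<Rightarrow> ('v, 'e) graph_pmap \<Rightarrow> bool" where
  "rooted_iso v H J \<phi> \<longleftrightarrow> graph_iso H J \<phi> \<and> vmap \<phi> v = Some v"

definition Tisg :: "('v, 'e) multigraph \<Rightarrow> 'v \<Rightarrow> ('v, 'e) graph_pmap set" where
  "Tisg G v = {\<phi>. \<exists>H J. rooted_tree_induced G v H \<and> rooted_tree_induced G v J \<and>
     rooted_iso v H J \<phi>}"

definition Dom :: "('v, 'e) multigraph \<Rightarrow> ('v, 'e) graph_pmap \<Rightarrow> ('v, 'e) multigraph" where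
  "Dom G \<phi> = \<lparr>verts = dom (vmap \<phi>), edges = dom (emap \<phi>), ends = ends G\<rparr>"

definition Im :: "('v, 'e) multigraph \<Rightarrow> ('v, 'e) graph_pmap \<Rightarrow> ('v, 'e) multigraph" where
  "Im G \<phi> = \<lparr>verts = ran (vmap \<phi>), edges = ran (emap \<phi>), ends = ends G\<rparr>"

definition comp_graph :: "('v, 'e) multigraph \<Rightarrow> 'v \<Rightarrow> ('v, 'e) graph_pmap \<Rightarrow>
    ('v, 'e) graph_pmap \<Rightarrow> ('v, 'e) multigraph" where
  "comp_graph G v \<psi> \<phi> = induced G {u. \<exists>p. path (Im G \<phi>) v p u \<and> path (Dom G \<psi>) v p u}"

text \<open>The product of \<open>\<psi>\<close> and \<open>\<phi>\<close>: first \<open>\<phi>\<close>, then \<open>\<psi>\<close>, restricted to the preimage under \<open>\<phi>\<close>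
  of \<^const>\<open>comp_graph\<close>.\<close>

definition Tisg_comp :: "('v, 'e) multigraph \<Rightarrow> 'v \<Rightarrow> ('v, 'e) graph_pmap \<Rightarrow>
    ('v, 'e) graph_pmap \<Rightarrow> ('v, 'e) graph_pmap" where
  "Tisg_comp G v \<psi> \<phi> =
     \<lparr>vmap = (vmap \<psi> \<circ>\<^sub>m vmap \<phi>) |` {x. \<exists>y \<in> verts (comp_graph G v \<psi> \<phi>). vmap \<phi> x = Some y},
      emap = (emap \<psi> \<circ>\<^sub>m emap \<phi>) |` {d. \<exists>e \<in> edges (comp_graph G v \<psi> \<phi>). emap \<phi> d = Some e}\<rparr>"

definition semigroup_ideal :: "'a set \<Rightarrow> ('a \<Rightarrow> 'a \<Rightarrow> 'a) \<Rightarrow> 'a set \<Rightarrow> bool" where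
  "semigroup_ideal S f I \<longleftrightarrow> I \<subseteq> S \<and> (\<forall>s\<in>S. \<forall>i\<in>I. f s i \<in> I \<and> f i s \<in> I)"

text \<open>Being isomorphic is meant in the category of graphs rooted at \<open>v\<close>: the isomorphism onto a
  subgraph of the domain of \<open>a\<close> fixes \<open>v\<close>.\<close>

definition embeds_in_Dom :: "('v, 'e) multigraph \<Rightarrow> 'v \<Rightarrow> ('v, 'e) graph_pmap \<Rightarrow>
    ('v, 'e) multigraph \<Rightarrow> bool" where
  "embeds_in_Dom G v a H \<longleftrightarrow>
     (\<exists>L \<chi>. rooted_connected_induced (Dom G a) v L \<and> rooted_iso v H L \<chi>)"

definition Tisg_ideal ::
    "('v, 'e) multigraph \<Rightarrow> 'v \<Rightarrow> ('v, 'e) graph_pmap \<Rightarrow> ('v, 'e) graph_pmap set" where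
  "Tisg_ideal G v a = {\<phi> \<in> Tisg G v. \<exists>H K. graph_iso H K \<phi> \<and>
     rooted_connected_induced G v H \<and> embeds_in_Dom G v a H \<and>
     rooted_connected_induced G v K \<and> embeds_in_Dom G v a K}"

end

theory Submission imports Defs begin

text \<open>By growing a maximal subtree, the \<open>v\<close>-rooted tree induced subgraphs are exactly the connected
  induced subgraphs containing \<open>v\<close>. A product in \<open>Tisg G v\<close> is therefore an honest composition of
  isomorphisms \<open>W \<rightarrow> C \<rightarrow> Z\<close> of such subgraphs, where \<open>C\<close> is contained in the domain of the left
  factor and in the image of the right one; since embeddability into the domain of \<open>a\<close> is invariant
  under isomorphism and passes to connected induced subgraphs, the set in question is an ideal.
  For minimality, let \<open>\<phi> : H \<rightarrow> K\<close> and let \<open>\<chi>\<close> be an isomorphism from \<open>H\<close> onto a subgraph \<open>L\<close> of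
  the domain of \<open>a\<close>. Then \<open>\<phi> = \<rho> \<circ> (a \<circ> \<chi>)\<close> with \<open>\<rho> = \<phi> \<circ> \<chi>\<inverse> \<circ> (a restricted to L)\<inverse>\<close>.\<close>

section \<open>Walks and connectedness\<close>

lemma walk_in_verts: "walk G x p y \<Longrightarrow> x \<in> verts G \<and> y \<in> verts G"
  by (induction G x p y rule: walk.induct) auto

lemma walk_append: "walk G x (p @ q) y \<longleftrightarrow> (\<exists>z. walk G x p z \<and> walk G z q y)"
proof (induction p arbitrary: x)
  case Nil
  then show ?case using walk_in_verts by fastforce
next
  case (Cons s p)
  then show ?case by (cases s) auto
qed

lemma walk_sym: "walk G x p y \<Longrightarrow> \<exists>q. walk G y q x"
proof (induction G x p y rule: walk.induct)
  case (1 G x y)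
  then show ?case by (intro exI[of _ "[]"]) auto
next
  case (2 G x e z p y)
  then obtain q where q: "walk G y q z" by auto
  with 2 have "walk G z [(e, x)] x"
    using walk_in_verts[OF q] by (auto simp: insert_commute)
  with q have "walk G y (q @ [(e, x)]) x" by (auto simp only: walk_append)
  then show ?case by blast
qed

text \<open>By recursion on the walk: if its start recurs on the path already found for the
  remainder, everything before that recurrence is cut off.\<close>

lemma walk_imp_path: "walk G x p y \<Longrightarrow> \<exists>q. path G x q y"
proof (induction G x p y rule: walk.induct)
  case (1 G x y)
  then show ?case by (intro exI[of _ "[]"]) (auto simp: path_def)
next
  case (2 G x e z p y)
  then obtain q where q: "path G z q y" by auto
  show ?case
  proof (cases "x = z \<or> x \<in> snd ` set q")
    case False
    with q 2 have "path G x ((e, z) # q) y" by (auto simp: path_def)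
    then show ?thesis by blast
  next
    case True
    then consider "x = z" | "x \<in> snd ` set q" by blast
    then show ?thesis
    proof cases
      case 1
      with q show ?thesis by blast
    next
      case 2
      then obtain d q1 q2 where "q = q1 @ (d, x) # q2" by (auto dest: split_list)
      with q have "path G x q2 y" by (auto simp: path_def walk_append)
      then show ?thesis by blast
    qed
  qed
qed

text \<open>Unlike paths, walks can be concatenated and reversed freely, so the later connectedness
  arguments use this form.\<close>

lemma connected_iff_walk:
  "connected G \<longleftrightarrow> verts G \<noteq> {} \<and> (\<forall>x\<in>verts G. \<forall>y\<in>verts G. \<exists>p. walk G x p y)"
  unfolding connected_def using walk_imp_path unfolding path_def by metis

text \<open>Two vertices are joined by walking back to the root and out again.\<close>

lemma connected_rootI:
  assumes "v \<in> verts G" and "\<And>x. x \<in> verts G \<Longrightarrow> \<exists>p. walk G v p x"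
  shows "connected G"
  unfolding connected_iff_walk using assms walk_sym walk_append by (metis empty_iff)

lemma walk_mono:
  assumes "walk H x p y" and "verts H \<subseteq> verts G" and "edges H \<subseteq> edges G"
    and "\<forall>e\<in>edges H. ends H e = ends G e"
  shows "walk G x p y"
  using assms by (induction H x p y rule: walk.induct) auto

text \<open>Serves to pass from a tree to the subgraph induced by its vertices, which may have more
  edges.\<close>

lemma connected_spanning:
  assumes "connected H" and "verts H = verts G" and "edges H \<subseteq> edges G"
    and "\<forall>e\<in>edges H. ends H e = ends G e"
  shows "connected G"
proof -
  have "\<exists>p. walk G x p y" if "x \<in> verts G" "y \<in> verts G" for x y
    using that assms walk_mono[of H x _ y G] by (metis connected_iff_walk subset_refl)
  with assms show ?thesis by (auto simp: connected_iff_walk)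
qed

section \<open>Induced subgraphs and spanning trees\<close>

lemma induced_simps [simp]:
  "verts (induced G X) = X"
  "edges (induced G X) = {e \<in> edges G. ends G e \<subseteq> X}"
  "ends (induced G X) = ends G"
  by (auto simp: induced_def)

lemma induced_induced: "Z \<subseteq> X \<Longrightarrow> induced (induced G X) Z = induced G Z"
  by (auto simp: induced_def)

lemma ends_subset_verts: "finite_multigraph G \<Longrightarrow> e \<in> edges G \<Longrightarrow> ends G e \<subseteq> verts G"
  by (auto simp: finite_multigraph_def)

lemma finite_multigraph_induced:
  assumes "finite_multigraph G" and "X \<subseteq> verts G"
  shows "finite_multigraph (induced G X)"
  using assms unfolding finite_multigraph_def induced_simps
  by (auto intro: finite_subset) (metis insert_subset)

text \<open>The ends of an edge lie in both sets iff they lie in the intersection, so the same list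
  \<open>p\<close> works on both sides. This later turns the common paths of an image and a domain
  into paths of one induced subgraph.\<close>

lemma walk_induced_Int:
  "walk (induced G (X \<inter> Y)) x p y \<longleftrightarrow> walk (induced G X) x p y \<and> walk (induced G Y) x p y"
  by (induction p arbitrary: x) auto

section \<open>Attaching a leaf to a tree\<close>

definition add_leaf :: "('v, 'e) multigraph \<Rightarrow> 'e \<Rightarrow> 'v \<Rightarrow> ('v, 'e) multigraph" where
  "add_leaf T e z = T\<lparr>verts := insert z (verts T), edges := insert e (edges T)\<rparr>"

lemma add_leaf_simps [simp]:
  "verts (add_leaf T e z) = insert z (verts T)"
  "edges (add_leaf T e z) = insert e (edges T)"
  "ends (add_leaf T e z) = ends T"
  by (auto simp: add_leaf_def)

lemma connected_add_leaf:
  assumes "connected T" and "ends T e = {x, z}" and "x \<in> verts T"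
  shows "connected (add_leaf T e z)"
proof (rule connected_rootI)
  show "x \<in> verts (add_leaf T e z)" using assms by simp
next
  fix u
  assume "u \<in> verts (add_leaf T e z)"
  then consider "u = z" | "u \<in> verts T" by auto
  then show "\<exists>p. walk (add_leaf T e z) x p u"
  proof cases
    case 1
    with assms have "walk (add_leaf T e z) x [(e, z)] u" by simp
    then show ?thesis by blast
  next
    case 2
    with assms obtain p where "walk T x p u" unfolding connected_iff_walk by blast
    then have "walk (add_leaf T e z) x p u" by (rule walk_mono) auto
    then show ?thesis by blast
  qed
qed

text \<open>Using the new edge would mean visiting its end \<open>z\<close>.\<close>

lemma walk_avoiding_leaf:
  assumes "walk (add_leaf T e z) x p y" and "z \<in> ends T e" and "x \<noteq> z" and "z \<notin> snd ` set p"
  shows "walk T x p y"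
  using assms by (induction p arbitrary: x) auto

lemma walk_last: "walk G x p y \<Longrightarrow> p \<noteq> [] \<Longrightarrow> y \<in> snd ` set p"
  by (induction G x p y rule: walk.induct) (case_tac p; auto)+

text \<open>A closed walk enters \<open>z\<close> by one edge and leaves it, cyclically, by the
  next. Both must be \<open>e\<close>, so distinctness of the edges leaves only a walk of length
  one, and \<open>e\<close> is a loop.\<close>

lemma walk_only_edge_at:
  assumes "walk G x p x" and "p \<noteq> []" and "z \<in> snd ` set p" and "distinct (map fst p)"
    and only: "\<And>d. d \<in> edges G \<Longrightarrow> z \<in> ends G d \<Longrightarrow> d = e"
  shows "ends G e = {z}"
proof -
  from \<open>z \<in> snd ` set p\<close> obtain e1 where "(e1, z) \<in> set p" by auto
  then obtain p1 p2 where p: "p = p1 @ (e1, z) # p2" by (meson split_list)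
  from assms(1) have e1: "e1 = e" unfolding p walk_append by (auto intro: only)
  show ?thesis
  proof (cases p2)
    case (Cons s p3)
    then have "fst s = e" using assms(1) unfolding p walk_append
      by (cases s) (auto intro: only)
    with p Cons e1 assms(4) show ?thesis by auto
  next
    case Nil
    \<comment> \<open>Here \<open>z\<close> is where the walk closes up, so the edge leaving
      \<open>z\<close> is the first one of the walk.\<close>
    then have xz: "x = z" using assms(1) unfolding p walk_append by auto
    show ?thesis
    proof (cases p1)
      case Nil
      with \<open>p2 = []\<close> p assms(1) xz e1 show ?thesis by auto
    next
      case (Cons s p3)
      then have "fst s = e" using assms(1) xz unfolding p by (cases s) (auto intro: only)
      with p Cons e1 assms(4) show ?thesis by auto
    qed
  qed
qed

text \<open>By \<open>sub\<close>, no edge of \<open>T\<close> touches \<open>z\<close>, so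
  \<open>e\<close> is the only edge there. A cycle through \<open>z\<close> would make
  \<open>e\<close> a loop, although its ends \<open>x\<close> and \<open>z\<close> differ; a cycle
  avoiding \<open>z\<close> would already lie in \<open>T\<close>.\<close>

lemma tree_add_leaf:
  assumes T: "tree T" and ends: "ends T e = {x, z}" and "x \<in> verts T" and "z \<notin> verts T"
    and sub: "\<And>d. d \<in> edges T \<Longrightarrow> ends T d \<subseteq> verts T"
  shows "tree (add_leaf T e z)"
proof -
  have "\<not> cycle (add_leaf T e z) u p" for u p
  proof
    assume c: "cycle (add_leaf T e z) u p"
    then have w: "walk (add_leaf T e z) u p u" and p: "p \<noteq> []" by (auto simp: cycle_def)
    show False
    proof (cases "z \<in> snd ` set p")
      case True
      have "ends (add_leaf T e z) e = {z}"
        using w p True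
      proof (rule walk_only_edge_at)
        show "distinct (map fst p)" using c by (simp add: cycle_def)
      qed (use sub assms in auto)
      with assms show False by auto
    next
      case False
      then have "u \<noteq> z" using walk_last[OF w p] by auto
      with w False ends have "walk T u p u" by (auto intro: walk_avoiding_leaf)
      with c T show False by (auto simp: cycle_def tree_def)
    qed
  qed
  with assms show ?thesis by (auto simp: tree_def intro: connected_add_leaf)
qed

text \<open>Take the first step of the walk that goes out of \<open>A\<close>.\<close>

lemma walk_leaves:
  "walk G x p y \<Longrightarrow> x \<in> A \<Longrightarrow> y \<notin> A \<Longrightarrow>
    \<exists>e\<in>edges G. \<exists>a\<in>A. \<exists>b\<in>verts G - A. ends G e = {a, b}"
proof (induction G x p y rule: walk.induct)
  case (1 G x y)
  then show ?case by simp
next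
  case (2 G x e z p y)
  then show ?case using walk_in_verts[of G z p y] by (cases "z \<in> A") auto
qed

text \<open>A subtree through \<open>v\<close> with the most vertices spans: otherwise an edge
  leaving it could be attached as a leaf.\<close>

lemma spanning_tree:
  assumes fin: "finite_multigraph H" and con: "connected H" and v: "v \<in> verts H"
  obtains T where "subgraph T H" and "tree T" and "verts T = verts H"
proof -
  define P where "P T \<longleftrightarrow> subgraph T H \<and> tree T \<and> v \<in> verts T" for T :: "('a, 'b) multigraph"
  define T0 where "T0 = \<lparr>verts = {v}, edges = {}, ends = ends H\<rparr>"
  have "connected T0"
    by (rule connected_rootI[of v]) (auto simp: T0_def intro: exI[of _ "[]"])
  moreover have "\<not> cycle T0 x p" for x p
    by (cases p) (auto simp: cycle_def T0_def)
  ultimately have "P T0" using v by (auto simp: P_def tree_def subgraph_def finite_multigraph_def T0_def)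
  \<comment> \<open>A strict upper bound on the measure, as required for the existence of a
    maximum.\<close>
  moreover have "card (verts T) < Suc (card (verts H))" if "P T" for T
    using that fin by (auto simp: P_def subgraph_def finite_multigraph_def less_Suc_eq_le intro: card_mono)
  ultimately obtain T where T: "P T" and max: "\<And>T'. P T' \<Longrightarrow> card (verts T') \<le> card (verts T)"
    using ex_has_greatest_nat[of P T0 "\<lambda>T. card (verts T)"] by metis
  have "verts T = verts H"
  proof (rule ccontr)
    assume "verts T \<noteq> verts H"
    then obtain u where u: "u \<in> verts H" "u \<notin> verts T" using T by (auto simp: P_def subgraph_def)
    then obtain p where "walk H v p u" using con v unfolding connected_iff_walk by blast
    then obtain e x z where e: "e \<in> edges H" "x \<in> verts T" "z \<in> verts H" "z \<notin> verts T"
      "ends H e = {x, z}"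
      using walk_leaves[of H v p u "verts T"] T u by (auto simp: P_def)
    \<comment> \<open>A subgraph agrees with \<open>ends H\<close> only on its own edges, which do not include the new edge \<open>e\<close>.\<close>
    define T1 where "T1 = T\<lparr>ends := ends H\<rparr>"
    have same: "verts T1 = verts T" "edges T1 = edges T" "ends T1 = ends H"
      by (auto simp: T1_def)
    have TH: "\<And>d. d \<in> edges T \<Longrightarrow> ends T d = ends H d" using T by (simp add: P_def subgraph_def)
    have walk_eq: "walk T1 a q b \<longleftrightarrow> walk T a q b" for a q b
      by (induction q arbitrary: a) (auto simp: same TH)
    have "tree T1" using T
      by (simp add: P_def tree_def connected_iff_walk cycle_def walk_eq same)
    then have "tree (add_leaf T1 e z)"
    proof (rule tree_add_leaf)
      show "ends T1 d \<subseteq> verts T1" if "d \<in> edges T1" for d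
        using that T ends_subset_verts[of T d] by (auto simp: same TH P_def subgraph_def)
    qed (use e same in auto)
    moreover have "subgraph (add_leaf T1 e z) H"
      using T e by (auto simp: P_def subgraph_def finite_multigraph_def same TH) (metis TH)+
    ultimately have "P (add_leaf T1 e z)" using T by (simp add: P_def same)
    from max[OF this] show False
      using T e by (simp add: same P_def subgraph_def finite_multigraph_def)
  qed
  with T that show thesis by (auto simp: P_def)
qed

text \<open>Removes trees from the rest of the argument: a tree spans the subgraph induced by its
  vertices, and a connected graph has a spanning tree.\<close>

lemma rooted_tree_induced_iff:
  assumes "finite_multigraph G"
  shows "rooted_tree_induced G v H \<longleftrightarrow> rooted_connected_induced G v H"
proof
  assume "rooted_tree_induced G v H"
  then obtain T where T: "subgraph T G" "tree T" "v \<in> verts T" "H = induced G (verts T)"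
    by (auto simp: rooted_tree_induced_def)
  have "connected H"
    by (rule connected_spanning[of T])
      (use T ends_subset_verts[of T] in \<open>fastforce simp: tree_def subgraph_def\<close>)+
  with T show "rooted_connected_induced G v H"
    by (auto simp: rooted_connected_induced_def subgraph_def)
next
  assume "rooted_connected_induced G v H"
  then obtain X where X: "X \<subseteq> verts G" "v \<in> X" "H = induced G X" "connected H"
    by (auto simp: rooted_connected_induced_def)
  moreover obtain T where "subgraph T H" "tree T" "verts T = verts H"
    using spanning_tree[of H v] finite_multigraph_induced[OF assms X(1)] X by auto
  ultimately show "rooted_tree_induced G v H"
    unfolding rooted_tree_induced_def
    by (intro exI[of _ T]) (auto simp: subgraph_def)
qed

section \<open>Isomorphisms as partial bijections\<close>

text \<open>Equivalent to conditions on \<open>dom\<close>, \<open>ran\<close> and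
  \<open>inj_on\<close> by \<open>pbij_iff\<close>. Stated through equations
  \<open>f x = Some y\<close> alone, it is nearly symmetric in arguments and values, which suits
  inverses and composites.\<close>

definition pbij :: "('a \<rightharpoonup> 'b) \<Rightarrow> 'a set \<Rightarrow> 'b set \<Rightarrow> bool" where
  "pbij f A B \<longleftrightarrow> (\<forall>x. x \<in> A \<longleftrightarrow> (\<exists>y. f x = Some y)) \<and> (\<forall>y. y \<in> B \<longleftrightarrow> (\<exists>x. f x = Some y)) \<and>
    (\<forall>x x' y. f x = Some y \<longrightarrow> f x' = Some y \<longrightarrow> x = x')"

definition map_inv :: "('a \<rightharpoonup> 'b) \<Rightarrow> ('b \<rightharpoonup> 'a)" where
  "map_inv f y = (if y \<in> ran f then Some (SOME x. f x = Some y) else None)"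

lemma pbij_iff: "pbij f A B \<longleftrightarrow> dom f = A \<and> ran f = B \<and> inj_on f A"
proof -
  have dom: "dom f = A \<longleftrightarrow> (\<forall>x. x \<in> A \<longleftrightarrow> (\<exists>y. f x = Some y))" by (auto simp: dom_def)
  have ran: "ran f = B \<longleftrightarrow> (\<forall>y. y \<in> B \<longleftrightarrow> (\<exists>x. f x = Some y))" by (auto simp: ran_def)
  show ?thesis
  proof (cases "dom f = A")
    case True
    then have "inj_on f A \<longleftrightarrow> (\<forall>x x' y. f x = Some y \<longrightarrow> f x' = Some y \<longrightarrow> x = x')"
      by (force simp: inj_on_def dom_def)
    then show ?thesis unfolding pbij_def dom ran by (simp only:)
  next
    case False
    then show ?thesis unfolding pbij_def dom by (simp only: simp_thms)
  qed
qed

text \<open>Injectivity makes the chosen preimage the only one, so \<open>SOME\<close> disappears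
  from all later reasoning.\<close>

lemma map_inv_eq_Some:
  assumes "pbij f A B"
  shows "map_inv f y = Some x \<longleftrightarrow> f x = Some y"
proof (cases "y \<in> ran f")
  case True
  then obtain x' where x': "f x' = Some y" by (auto simp: ran_def)
  have inj: "f w = Some y \<Longrightarrow> w = x'" for w using assms x' unfolding pbij_def by blast
  then have "(SOME w. f w = Some y) = x'" using x' by (intro some_equality)
  with True have "map_inv f y = Some x'" by (simp add: map_inv_def)
  with inj x' show ?thesis by (metis option.inject)
next
  case False
  then show ?thesis by (auto simp: map_inv_def ran_def)
qed

lemma pbij_map_inv:
  assumes "pbij f A B"
  shows "pbij (map_inv f) B A"
  unfolding pbij_def map_inv_eq_Some[OF assms]
  using assms unfolding pbij_def by (metis option.inject)

lemma pbijD: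
  assumes "pbij f A B"
  shows "x \<in> A \<longleftrightarrow> (\<exists>y. f x = Some y)" and "y \<in> B \<longleftrightarrow> (\<exists>x. f x = Some y)"
    and "f x = Some y \<Longrightarrow> f x' = Some y \<Longrightarrow> x = x'"
  using assms by (simp_all add: pbij_def)

lemma pbij_map_comp:
  assumes "pbij f A B" and "pbij g B C"
  shows "pbij (g \<circ>\<^sub>m f) A C"
  unfolding pbij_def map_comp_Some_iff
proof (intro conjI allI impI)
  show "x \<in> A \<longleftrightarrow> (\<exists>z y. f x = Some y \<and> g y = Some z)" for x
    using pbijD(1,2)[OF assms(1)] pbijD(1)[OF assms(2)] by meson
  show "z \<in> C \<longleftrightarrow> (\<exists>x y. f x = Some y \<and> g y = Some z)" for z
    using pbijD(2)[OF assms(1)] pbijD(1,2)[OF assms(2)] by meson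
  show "x = x'" if "\<exists>y. f x = Some y \<and> g y = Some z" "\<exists>y. f x' = Some y \<and> g y = Some z" for x x' z
    using that pbijD(3)[OF assms(1)] pbijD(3)[OF assms(2)] by blast
qed

lemma pbij_restrict:
  assumes f: "pbij f A B" and sub: "A' \<subseteq> A" "B' \<subseteq> B"
    and AB: "\<And>x y. f x = Some y \<Longrightarrow> x \<in> A' \<longleftrightarrow> y \<in> B'"
  shows "pbij (f |` A') A' B'"
proof -
  have eq: "(f |` A') x = Some y \<longleftrightarrow> x \<in> A' \<and> f x = Some y" for x y
    by (simp add: restrict_map_def)
  show ?thesis unfolding pbij_def eq
  proof (intro conjI allI impI)
    show "x \<in> A' \<longleftrightarrow> (\<exists>y. x \<in> A' \<and> f x = Some y)" for x
      using pbijD(1)[OF f, of x] sub by blast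
    show "y \<in> B' \<longleftrightarrow> (\<exists>x. x \<in> A' \<and> f x = Some y)" for y
      using pbijD(2)[OF f, of y] sub AB by blast
    show "x = x'" if "x \<in> A' \<and> f x = Some y" "x' \<in> A' \<and> f x' = Some y" for x x' y
      using that pbijD(3)[OF f] by blast
  qed
qed

text \<open>Trades \<open>the\<close> for \<open>Some\<close> equations, under which inversion and
  composition only rename or chain variables.\<close>

lemma graph_iso_iff:
  "graph_iso H J \<phi> \<longleftrightarrow> pbij (vmap \<phi>) (verts H) (verts J) \<and> pbij (emap \<phi>) (edges H) (edges J) \<and>
    (\<forall>x x' e e'. vmap \<phi> x = Some x' \<longrightarrow> emap \<phi> e = Some e' \<longrightarrow> (x \<in> ends H e \<longleftrightarrow> x' \<in> ends J e'))"
proof -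
  have "(\<forall>x\<in>verts H. \<forall>e\<in>edges H. x \<in> ends H e \<longleftrightarrow> the (vmap \<phi> x) \<in> ends J (the (emap \<phi> e))) \<longleftrightarrow>
    (\<forall>x x' e e'. vmap \<phi> x = Some x' \<longrightarrow> emap \<phi> e = Some e' \<longrightarrow> (x \<in> ends H e \<longleftrightarrow> x' \<in> ends J e'))"
    if "pbij (vmap \<phi>) (verts H) (verts J)" "pbij (emap \<phi>) (edges H) (edges J)"
  proof -
    have "x \<in> verts H \<longleftrightarrow> (\<exists>y. vmap \<phi> x = Some y)" "e \<in> edges H \<longleftrightarrow> (\<exists>d. emap \<phi> e = Some d)" for x e
      using that by (simp_all add: pbij_def)
    then show ?thesis unfolding Ball_def by (metis option.sel)
  qed
  then show ?thesis unfolding graph_iso_def pbij_iff by blast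
qed

lemma graph_iso_vmap:
  assumes "graph_iso H J \<phi>"
  shows "x \<in> verts H \<longleftrightarrow> (\<exists>y. vmap \<phi> x = Some y)"
    and "y \<in> verts J \<longleftrightarrow> (\<exists>x. vmap \<phi> x = Some y)"
    and "vmap \<phi> x = Some y \<Longrightarrow> vmap \<phi> x' = Some y \<Longrightarrow> x = x'"
  using assms unfolding graph_iso_iff pbij_def by blast+

lemma graph_iso_emap:
  assumes "graph_iso H J \<phi>"
  shows "e \<in> edges H \<longleftrightarrow> (\<exists>d. emap \<phi> e = Some d)"
    and "d \<in> edges J \<longleftrightarrow> (\<exists>e. emap \<phi> e = Some d)"
  using assms unfolding graph_iso_iff pbij_def by blast+

lemma graph_iso_incident:
  "graph_iso H J \<phi> \<Longrightarrow> vmap \<phi> x = Some x' \<Longrightarrow> emap \<phi> e = Some e' \<Longrightarrow>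
    x \<in> ends H e \<longleftrightarrow> x' \<in> ends J e'"
  unfolding graph_iso_iff by blast

section \<open>Inverse, composition and restriction of isomorphisms\<close>

definition pmap_inv :: "('v, 'e) graph_pmap \<Rightarrow> ('v, 'e) graph_pmap" where
  "pmap_inv \<phi> = \<lparr>vmap = map_inv (vmap \<phi>), emap = map_inv (emap \<phi>)\<rparr>"

definition pmap_comp :: "('v, 'e) graph_pmap \<Rightarrow> ('v, 'e) graph_pmap \<Rightarrow> ('v, 'e) graph_pmap" where
  "pmap_comp \<psi> \<phi> = \<lparr>vmap = vmap \<psi> \<circ>\<^sub>m vmap \<phi>, emap = emap \<psi> \<circ>\<^sub>m emap \<phi>\<rparr>"

definition pmap_restrict :: "('v, 'e) graph_pmap \<Rightarrow> ('v, 'e) multigraph \<Rightarrow> ('v, 'e) graph_pmap" where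
  "pmap_restrict \<phi> H = \<lparr>vmap = vmap \<phi> |` verts H, emap = emap \<phi> |` edges H\<rparr>"

lemma graph_iso_inv: "graph_iso H J \<phi> \<Longrightarrow> graph_iso J H (pmap_inv \<phi>)"
  unfolding graph_iso_iff pmap_inv_def
  by (clarsimp simp: pbij_map_inv map_inv_eq_Some)

lemma rooted_iso_inv:
  assumes "rooted_iso v H J \<phi>"
  shows "rooted_iso v J H (pmap_inv \<phi>)"
proof -
  have g: "graph_iso H J \<phi>" and v: "vmap \<phi> v = Some v" using assms by (auto simp: rooted_iso_def)
  from g have "pbij (vmap \<phi>) (verts H) (verts J)" unfolding graph_iso_iff by blast
  with v have "vmap (pmap_inv \<phi>) v = Some v" by (simp add: pmap_inv_def map_inv_eq_Some)
  with graph_iso_inv[OF g] show ?thesis by (simp add: rooted_iso_def)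
qed

lemma rooted_iso_comp:
  assumes "rooted_iso v H J \<phi>" and "rooted_iso v J K \<psi>"
  shows "rooted_iso v H K (pmap_comp \<psi> \<phi>)"
  unfolding rooted_iso_def graph_iso_iff
proof (intro conjI allI impI)
  have g: "graph_iso H J \<phi>" "graph_iso J K \<psi>" and v: "vmap \<phi> v = Some v" "vmap \<psi> v = Some v"
    using assms by (auto simp: rooted_iso_def)
  show "vmap (pmap_comp \<psi> \<phi>) v = Some v" using v by (simp add: pmap_comp_def)
  show "pbij (vmap (pmap_comp \<psi> \<phi>)) (verts H) (verts K)"
    and "pbij (emap (pmap_comp \<psi> \<phi>)) (edges H) (edges K)"
    using g unfolding graph_iso_iff pmap_comp_def by (simp_all, (blast intro: pbij_map_comp)+)
  fix x x' e e'
  assume "vmap (pmap_comp \<psi> \<phi>) x = Some x'" "emap (pmap_comp \<psi> \<phi>) e = Some e'"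
  then obtain y d where "vmap \<phi> x = Some y" "vmap \<psi> y = Some x'" "emap \<phi> e = Some d" "emap \<psi> d = Some e'"
    by (auto simp: pmap_comp_def map_comp_Some_iff)
  then show "x \<in> ends H e \<longleftrightarrow> x' \<in> ends K e'"
    using graph_iso_incident[OF g(1)] graph_iso_incident[OF g(2)] by metis
qed

section \<open>Transport of ends, walks and connectedness\<close>

lemma graph_iso_ends:
  assumes iso: "graph_iso H J \<phi>" and fin: "finite_multigraph H" "finite_multigraph J"
    and e: "emap \<phi> e = Some e'"
  shows "ends J e' = {y. \<exists>x\<in>ends H e. vmap \<phi> x = Some y}"
proof -
  \<comment> \<open>Incidence is compared only at vertices where \<open>vmap \<phi>\<close> is
    defined. That \<open>ends J e'\<close> consists of vertices of \<open>J\<close> gives each of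
    its members a preimage.\<close>
  have sub: "ends J e' \<subseteq> verts J"
    using e ends_subset_verts[OF fin(2)] graph_iso_emap(2)[OF iso] by blast
  have "y \<in> ends J e' \<longleftrightarrow> (\<exists>x\<in>ends H e. vmap \<phi> x = Some y)" for y
  proof
    assume y: "y \<in> ends J e'"
    with sub obtain x where "vmap \<phi> x = Some y" using graph_iso_vmap(2)[OF iso] by blast
    with y show "\<exists>x\<in>ends H e. vmap \<phi> x = Some y" using graph_iso_incident[OF iso _ e] by blast
  next
    assume "\<exists>x\<in>ends H e. vmap \<phi> x = Some y"
    then show "y \<in> ends J e'" using graph_iso_incident[OF iso _ e] by blast
  qed
  then show ?thesis by blast
qed

lemma graph_iso_edges_restrict:
  assumes iso: "graph_iso H J \<phi>" and fin: "finite_multigraph H" "finite_multigraph J"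
    and WZ: "\<And>x y. vmap \<phi> x = Some y \<Longrightarrow> x \<in> W \<longleftrightarrow> y \<in> Z" and e: "emap \<phi> e = Some e'"
  shows "e \<in> edges (induced H W) \<longleftrightarrow> e' \<in> edges (induced J Z)"
proof -
  have *: "e \<in> edges H" "e' \<in> edges J"
    using e graph_iso_emap(1,2)[OF iso] by blast+
  have "\<exists>y. vmap \<phi> x = Some y" if "x \<in> ends H e" for x
    using that ends_subset_verts[OF fin(1) *(1)] graph_iso_vmap(1)[OF iso] by blast
  then have "ends H e \<subseteq> W \<longleftrightarrow> ends J e' \<subseteq> Z"
    unfolding graph_iso_ends[OF iso fin e] using WZ by blast
  with * show ?thesis by simp
qed

text \<open>\<open>W\<close> and \<open>Z\<close> enter symmetrically, so the lemma covers both
  cases below: \<open>Z\<close> as the image of a given \<open>W\<close>, and \<open>W\<close> as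
  the preimage of a given \<open>Z\<close>.\<close>

lemma graph_iso_restrict:
  assumes iso: "graph_iso H J \<phi>" and "finite_multigraph H" and "finite_multigraph J"
    and "W \<subseteq> verts H" and "Z \<subseteq> verts J"
    and WZ: "\<And>x y. vmap \<phi> x = Some y \<Longrightarrow> x \<in> W \<longleftrightarrow> y \<in> Z"
  shows "graph_iso (induced H W) (induced J Z) (pmap_restrict \<phi> (induced H W))"
proof -
  have "pbij (vmap \<phi> |` W) W Z"
    using iso \<open>W \<subseteq> verts H\<close> \<open>Z \<subseteq> verts J\<close> WZ unfolding graph_iso_iff by (blast intro: pbij_restrict)
  moreover have "pbij (emap \<phi> |` edges (induced H W)) (edges (induced H W)) (edges (induced J Z))"
  proof (rule pbij_restrict)
    show "pbij (emap \<phi>) (edges H) (edges J)" using iso unfolding graph_iso_iff by blast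
    show "e \<in> edges (induced H W) \<longleftrightarrow> e' \<in> edges (induced J Z)" if "emap \<phi> e = Some e'" for e e'
      using graph_iso_edges_restrict[OF assms(1-3) WZ that] .
  qed auto
  moreover have "x \<in> ends H e \<longleftrightarrow> x' \<in> ends J e'"
    if "(vmap \<phi> |` W) x = Some x'" "(emap \<phi> |` edges (induced H W)) e = Some e'" for x x' e e'
    using that graph_iso_incident[OF iso, of x x' e e'] by (simp add: restrict_map_def split: if_splits)
  ultimately show ?thesis by (simp add: graph_iso_iff pmap_restrict_def)
qed

text \<open>The walk is mapped step by step; \<open>graph_iso_ends\<close> shows that each image
  edge joins the image vertices.\<close>

lemma graph_iso_walk:
  assumes iso: "graph_iso H J \<phi>" and "finite_multigraph H" and "finite_multigraph J"
  shows "walk H x p y \<Longrightarrow> vmap \<phi> x = Some x' \<Longrightarrow> vmap \<phi> y = Some y' \<Longrightarrow> \<exists>q. walk J x' q y'"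
proof (induction p arbitrary: x x')
  case Nil
  then have "walk J x' [] y'" using graph_iso_vmap(2)[OF iso] by auto
  then show ?case by blast
next
  case (Cons s p)
  obtain e z where s: "s = (e, z)" by (cases s)
  with Cons.prems have e: "e \<in> edges H" "ends H e = {x, z}" and w: "walk H z p y" by auto
  obtain z' where z': "vmap \<phi> z = Some z'"
    using walk_in_verts[OF w] graph_iso_vmap(1)[OF iso] by blast
  obtain e' where e': "emap \<phi> e = Some e'"
    using e graph_iso_emap(1)[OF iso] by blast
  have "ends J e' = {x', z'}"
    unfolding graph_iso_ends[OF assms e'] using e z' Cons.prems by auto
  moreover have "e' \<in> edges J" "x' \<in> verts J"
    using e' Cons.prems graph_iso_emap(2)[OF iso] graph_iso_vmap(2)[OF iso] by blast+
  moreover obtain q where "walk J z' q y'" using Cons.IH[OF w z'] Cons.prems by blast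
  ultimately have "walk J x' ((e', z') # q) y'" by simp
  then show ?case by blast
qed

lemma graph_iso_connected:
  assumes iso: "graph_iso H J \<phi>" and "finite_multigraph H" and "finite_multigraph J"
    and "connected H"
  shows "connected J"
  unfolding connected_iff_walk
proof (intro conjI ballI)
  show "verts J \<noteq> {}" using assms graph_iso_vmap(1,2)[OF iso] unfolding connected_def by blast
next
  fix x' y' assume "x' \<in> verts J" "y' \<in> verts J"
  then obtain x y where xy: "vmap \<phi> x = Some x'" "vmap \<phi> y = Some y'"
    using graph_iso_vmap(2)[OF iso] by blast
  then have "x \<in> verts H" "y \<in> verts H" using graph_iso_vmap(1)[OF iso] by blast+
  then obtain p where "walk H x p y" using assms unfolding connected_iff_walk by blast
  then show "\<exists>q. walk J x' q y'" using graph_iso_walk[OF assms(1-3)] xy by blast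
qed

lemma rooted_iso_restrict_dom:
  assumes iso: "rooted_iso v H J \<phi>" and fin: "finite_multigraph H" "finite_multigraph J"
    and W: "W \<subseteq> verts H" "v \<in> W" "connected (induced H W)"
  obtains Z where "Z \<subseteq> verts J" and "v \<in> Z" and "connected (induced J Z)"
    and "rooted_iso v (induced H W) (induced J Z) (pmap_restrict \<phi> (induced H W))"
proof -
  define Z where "Z = {y. \<exists>x\<in>W. vmap \<phi> x = Some y}"
  have g: "graph_iso H J \<phi>" and v: "vmap \<phi> v = Some v" using iso by (auto simp: rooted_iso_def)
  have Z: "Z \<subseteq> verts J" using graph_iso_vmap(2)[OF g] by (auto simp: Z_def)
  have WZ: "x \<in> W \<longleftrightarrow> y \<in> Z" if "vmap \<phi> x = Some y" for x y
    using that graph_iso_vmap(3)[OF g] by (auto simp: Z_def)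
  have r: "graph_iso (induced H W) (induced J Z) (pmap_restrict \<phi> (induced H W))"
    using graph_iso_restrict[OF g fin W(1) Z WZ] by simp
  show thesis
  proof (rule that[OF Z])
    show "v \<in> Z" using W v by (auto simp: Z_def)
    show "connected (induced J Z)"
      using graph_iso_connected[OF r] W Z fin finite_multigraph_induced by blast
    show "rooted_iso v (induced H W) (induced J Z) (pmap_restrict \<phi> (induced H W))"
      using r v W by (simp add: rooted_iso_def pmap_restrict_def)
  qed
qed

text \<open>\<open>W\<close> and the set of edges in the fourth conclusion have the form of the
  restrictions in \<open>Tisg_comp\<close>, so that they can be recognised there.\<close>

lemma rooted_iso_restrict_ran:
  assumes iso: "rooted_iso v H J \<phi>" and fin: "finite_multigraph H" "finite_multigraph J"
    and Z: "Z \<subseteq> verts J" "v \<in> Z" "connected (induced J Z)"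
    and W_def: "W = {x. \<exists>y\<in>Z. vmap \<phi> x = Some y}"
  shows "W \<subseteq> verts H" and "v \<in> W" and "connected (induced H W)"
    and "edges (induced H W) = {d. \<exists>e\<in>edges (induced J Z). emap \<phi> d = Some e}"
    and "rooted_iso v (induced H W) (induced J Z) (pmap_restrict \<phi> (induced H W))"
proof -
  have g: "graph_iso H J \<phi>" and v: "vmap \<phi> v = Some v" using iso by (auto simp: rooted_iso_def)
  show W: "W \<subseteq> verts H" using graph_iso_vmap(1)[OF g] by (auto simp: W_def)
  show vW: "v \<in> W" using Z v by (auto simp: W_def)
  have WZ: "x \<in> W \<longleftrightarrow> y \<in> Z" if "vmap \<phi> x = Some y" for x y
    using that by (auto simp: W_def)
  have r: "graph_iso (induced H W) (induced J Z) (pmap_restrict \<phi> (induced H W))"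
    using graph_iso_restrict[OF g fin W Z(1) WZ] by simp
  show "connected (induced H W)"
    using graph_iso_connected[OF graph_iso_inv[OF r]] W Z fin finite_multigraph_induced by blast
  have "edges (induced H W) \<subseteq> edges H" by auto
  then show "edges (induced H W) = {d. \<exists>e\<in>edges (induced J Z). emap \<phi> d = Some e}"
    using graph_iso_edges_restrict[OF g fin WZ] graph_iso_emap(1)[OF g] by blast
  show "rooted_iso v (induced H W) (induced J Z) (pmap_restrict \<phi> (induced H W))"
    using r v vW by (simp add: rooted_iso_def pmap_restrict_def)
qed

text \<open>\<open>f\<close> and \<open>g\<close> have the same domain, so the two sides also agree
  where they are undefined. This makes the cancellation an equality of partial maps.\<close>

lemma map_comp_map_inv:
  assumes "pbij g A B" and "pbij f A C"
  shows "(f \<circ>\<^sub>m map_inv g) \<circ>\<^sub>m g = f"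
proof
  fix x
  show "((f \<circ>\<^sub>m map_inv g) \<circ>\<^sub>m g) x = f x"
  proof (cases "g x")
    case None
    then have "f x = None" using pbijD(1)[OF assms(1), of x] pbijD(1)[OF assms(2), of x] by simp
    with None show ?thesis by (simp add: map_comp_def)
  next
    case (Some y)
    then have "map_inv g y = Some x" using map_inv_eq_Some[OF assms(1)] by simp
    with Some show ?thesis by (simp add: map_comp_def)
  qed
qed

lemma pmap_comp_inv_cancel:
  assumes "graph_iso H J \<theta>" and "graph_iso H K \<phi>"
  shows "pmap_comp (pmap_comp \<phi> (pmap_inv \<theta>)) \<theta> = \<phi>"
proof -
  have "(vmap \<phi> \<circ>\<^sub>m map_inv (vmap \<theta>)) \<circ>\<^sub>m vmap \<theta> = vmap \<phi>"
    using assms unfolding graph_iso_iff by (blast intro: map_comp_map_inv)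
  moreover have "(emap \<phi> \<circ>\<^sub>m map_inv (emap \<theta>)) \<circ>\<^sub>m emap \<theta> = emap \<phi>"
    using assms unfolding graph_iso_iff by (blast intro: map_comp_map_inv)
  ultimately show ?thesis by (simp add: pmap_comp_def pmap_inv_def)
qed

section \<open>Products in Tisg\<close>

text \<open>An induced subgraph is determined by its vertex set, so the rooted subgraphs can be
  handled as sets.\<close>

definition rooted_sets :: "('v, 'e) multigraph \<Rightarrow> 'v \<Rightarrow> 'v set set" where
  "rooted_sets G v = {X. X \<subseteq> verts G \<and> v \<in> X \<and> connected (induced G X)}"

lemma rooted_connected_induced_iff:
  "rooted_connected_induced G v H \<longleftrightarrow> (\<exists>X\<in>rooted_sets G v. H = induced G X)"
  unfolding rooted_connected_induced_def rooted_sets_def by blast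

lemma Tisg_iff:
  assumes "finite_multigraph G"
  shows "\<phi> \<in> Tisg G v \<longleftrightarrow> (\<exists>X\<in>rooted_sets G v. \<exists>Y\<in>rooted_sets G v.
    rooted_iso v (induced G X) (induced G Y) \<phi>)"
  unfolding Tisg_def rooted_tree_induced_iff[OF assms] rooted_connected_induced_iff by blast

text \<open>An equality of records: both graphs carry the whole function
  \<open>ends G\<close>.\<close>

lemma Dom_eq_induced: "graph_iso (induced G X) J \<phi> \<Longrightarrow> Dom G \<phi> = induced G X"
  unfolding graph_iso_def Dom_def by (simp add: induced_def)

lemma Im_eq_induced: "graph_iso H (induced G Y) \<phi> \<Longrightarrow> Im G \<phi> = induced G Y"
  unfolding graph_iso_def Im_def by (simp add: induced_def)

section \<open>The component of the root in an induced subgraph\<close>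

definition component :: "('v, 'e) multigraph \<Rightarrow> 'v \<Rightarrow> 'v set \<Rightarrow> 'v set" where
  "component G v Z = {u. \<exists>p. walk (induced G Z) v p u}"

lemma component_subset: "component G v Z \<subseteq> Z"
  using walk_in_verts[of "induced G Z"] by (auto simp: component_def)

lemma component_eq: "connected (induced G Z) \<Longrightarrow> v \<in> Z \<Longrightarrow> component G v Z = Z"
  using component_subset[of G v Z] by (auto simp: component_def connected_iff_walk)

text \<open>Each vertex met on the way is again reachable from \<open>v\<close>, by extending a walk
  to its predecessor.\<close>

lemma walk_in_component:
  "walk (induced G Z) x p y \<Longrightarrow> x \<in> component G v Z \<Longrightarrow> walk (induced G (component G v Z)) x p y"
proof (induction p arbitrary: x)
  case Nil
  then show ?case by simp
next
  case (Cons s p)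
  obtain e z where s: "s = (e, z)" by (cases s)
  with Cons.prems have e: "e \<in> edges G" "ends G e = {x, z}" and w: "walk (induced G Z) z p y"
    by auto
  obtain q where "walk (induced G Z) v q x" using Cons.prems by (auto simp: component_def)
  moreover have "walk (induced G Z) x [(e, z)] z"
    using Cons.prems s walk_in_verts[OF w] by auto
  ultimately have "walk (induced G Z) v (q @ [(e, z)]) z" by (auto simp only: walk_append)
  then have z: "z \<in> component G v Z" by (auto simp: component_def)
  with Cons.IH[OF w] Cons.prems e s show ?case by simp
qed

lemma component_in_rooted_sets:
  assumes "Z \<subseteq> verts G" and "v \<in> Z"
  shows "component G v Z \<in> rooted_sets G v"
proof -
  have "walk (induced G Z) v [] v" using assms by simp
  then have v: "v \<in> component G v Z" unfolding component_def by blast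
  have "connected (induced G (component G v Z))"
  proof (rule connected_rootI)
    show "v \<in> verts (induced G (component G v Z))" using v by simp
    fix u assume "u \<in> verts (induced G (component G v Z))"
    then obtain p where "walk (induced G Z) v p u" by (auto simp: component_def)
    then have "walk (induced G (component G v Z)) v p u" using v by (rule walk_in_component)
    then show "\<exists>p. walk (induced G (component G v Z)) v p u" ..
  qed
  with v assms component_subset[of G v Z] show ?thesis by (auto simp: rooted_sets_def)
qed

text \<open>The definition asks for one path lying in both graphs, that is, a path in the subgraph
  induced by the intersection of their vertex sets.\<close>

lemma comp_graph_eq:
  assumes "graph_iso H (induced G Y) \<phi>" and "graph_iso (induced G X) J \<psi>"
  shows "comp_graph G v \<psi> \<phi> = induced G (component G v (Y \<inter> X))"
proof -
  have "(\<exists>p. path (induced G Y) v p u \<and> path (induced G X) v p u) \<longleftrightarrow>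
      (\<exists>p. path (induced G (Y \<inter> X)) v p u)" for u
    by (auto simp: path_def walk_induced_Int)
  also have "\<dots> u \<longleftrightarrow> (\<exists>p. walk (induced G (Y \<inter> X)) v p u)" for u
    using walk_imp_path by (auto simp: path_def)
  finally show ?thesis
    unfolding comp_graph_def Im_eq_induced[OF assms(1)] Dom_eq_induced[OF assms(2)] component_def
    by simp
qed

text \<open>The factors are \<open>\<phi>\<close> restricted to the preimage \<open>W\<close> of the
  component \<open>C\<close>, and \<open>\<psi>\<close> restricted to \<open>C\<close>, with image
  \<open>Z\<close>.\<close>

lemma Tisg_comp_iso:
  assumes fin: "finite_multigraph G"
    and X: "X \<in> rooted_sets G v" "X' \<in> rooted_sets G v" and Y: "Y \<in> rooted_sets G v" "Y' \<in> rooted_sets G v"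
    and \<phi>: "rooted_iso v (induced G X) (induced G Y) \<phi>"
    and \<psi>: "rooted_iso v (induced G X') (induced G Y') \<psi>"
  obtains W C Z \<phi>' \<psi>' where "W \<in> rooted_sets G v" "C \<in> rooted_sets G v" "Z \<in> rooted_sets G v"
    and "C \<subseteq> Y \<inter> X'"
    and "rooted_iso v (induced G W) (induced G C) \<phi>'" and "rooted_iso v (induced G C) (induced G Z) \<psi>'"
    and "Tisg_comp G v \<psi> \<phi> = pmap_comp \<psi>' \<phi>'"
proof -
  define C where "C = component G v (Y \<inter> X')"
  have C: "C \<in> rooted_sets G v" "C \<subseteq> Y" "C \<subseteq> X'"
    using component_in_rooted_sets[of "Y \<inter> X'" G v] component_subset[of G v "Y \<inter> X'"] X Y
    by (auto simp: C_def rooted_sets_def)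
  have fins: "finite_multigraph (induced G S)" if "S \<in> rooted_sets G v" for S
    using that finite_multigraph_induced[OF fin] by (auto simp: rooted_sets_def)
  have cg: "comp_graph G v \<psi> \<phi> = induced G C"
    unfolding C_def by (rule comp_graph_eq) (use \<phi> \<psi> in \<open>auto simp: rooted_iso_def\<close>)
  have ind: "induced (induced G Y) C = induced G C" "induced (induced G X') C = induced G C"
    using C by (simp_all add: induced_induced)
  define W where "W = {x. \<exists>y\<in>C. vmap \<phi> x = Some y}"
  have vC: "v \<in> C" "connected (induced G C)" using C by (auto simp: rooted_sets_def)
  note W = rooted_iso_restrict_ran[OF \<phi> fins[OF X(1)] fins[OF Y(1)], of C W, unfolded ind induced_simps(1),
      OF C(2) vC W_def]
  have indW: "induced (induced G X) W = induced G W" using W(1) by (rule induced_induced)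
  have "W \<in> rooted_sets G v" using W(1-3) X by (auto simp: rooted_sets_def indW)
  have connC: "connected (induced (induced G X') C)" using vC ind by simp
  obtain Z where Z: "Z \<subseteq> verts (induced G Y')" "v \<in> Z" "connected (induced (induced G Y') Z)"
    "rooted_iso v (induced (induced G X') C) (induced (induced G Y') Z) (pmap_restrict \<psi> (induced (induced G X') C))"
    using rooted_iso_restrict_dom[OF \<psi> fins[OF X(2)] fins[OF Y(2)] _ vC(1) connC] C(3) by auto
  have indZ: "induced (induced G Y') Z = induced G Z" using Z(1) by (simp add: induced_induced)
  have "Z \<in> rooted_sets G v" using Z(1-3) Y by (auto simp: rooted_sets_def indZ)
  \<comment> \<open>Restricting a composite to the preimage of \<open>B\<close> is the same as
    restricting each factor: the inner one to that preimage, the outer one to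
    \<open>B\<close>.\<close>
  have restr: "(g \<circ>\<^sub>m f) |` {x. \<exists>y\<in>B. f x = Some y} = (g |` B) \<circ>\<^sub>m (f |` {x. \<exists>y\<in>B. f x = Some y})"
    for f :: "'c \<rightharpoonup> 'd" and g :: "'d \<rightharpoonup> 'c" and B
    by (auto simp: fun_eq_iff restrict_map_def map_comp_def split: option.splits)
  have "edges (induced G W) = {d. \<exists>e\<in>edges (induced G C). emap \<phi> d = Some e}"
    using W(4) unfolding indW .
  then have "Tisg_comp G v \<psi> \<phi> = pmap_comp (pmap_restrict \<psi> (induced G C)) (pmap_restrict \<phi> (induced G W))"
    unfolding Tisg_comp_def cg pmap_comp_def pmap_restrict_def
    by (simp only: restr induced_simps(1) W_def graph_pmap.simps)
  with that[of W C Z "pmap_restrict \<phi> (induced G W)" "pmap_restrict \<psi> (induced G C)"]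
  show thesis
    using \<open>W \<in> _\<close> \<open>Z \<in> _\<close> C W(5) Z(4) by (simp add: indW indZ ind)
qed

text \<open>If the image of \<open>\<phi>\<close> lies in the domain of \<open>\<psi>\<close>, their
  intersection is that connected image, so the product cuts nothing off.\<close>

lemma Tisg_comp_full:
  assumes Y: "connected (induced G Y)" "v \<in> Y" "Y \<subseteq> X"
    and \<phi>: "graph_iso H (induced G Y) \<phi>" and \<psi>: "graph_iso (induced G X) J \<psi>"
  shows "Tisg_comp G v \<psi> \<phi> = pmap_comp \<psi> \<phi>"
proof -
  have "Y \<inter> X = Y" using Y by blast
  then have cg: "comp_graph G v \<psi> \<phi> = induced G Y"
    using comp_graph_eq[OF \<phi> \<psi>] component_eq[OF Y(1,2)] by simp
  have restr: "(g \<circ>\<^sub>m f) |` {x. \<exists>y\<in>B. f x = Some y} = g \<circ>\<^sub>m f" if "\<And>x y. f x = Some y \<Longrightarrow> y \<in> B"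
    for f :: "'c \<rightharpoonup> 'd" and g :: "'d \<rightharpoonup> 'c" and B
    using that by (fastforce simp: fun_eq_iff restrict_map_def map_comp_def split: option.splits)
  have "y \<in> verts (induced G Y)" if "vmap \<phi> x = Some y" for x y
    using that graph_iso_vmap(2)[OF \<phi>] by blast
  moreover have "e \<in> edges (induced G Y)" if "emap \<phi> d = Some e" for d e
    using that graph_iso_emap(2)[OF \<phi>] by blast
  ultimately show ?thesis
    unfolding Tisg_comp_def cg pmap_comp_def by (simp only: restr)
qed

section \<open>The ideal generated by an element\<close>

lemma embeds_in_Dom_iso:
  assumes "embeds_in_Dom G v a H" and "rooted_iso v J H \<phi>"
  shows "embeds_in_Dom G v a J"
proof -
  obtain L \<chi> where "rooted_connected_induced (Dom G a) v L" and "rooted_iso v H L \<chi>"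
    using assms(1) unfolding embeds_in_Dom_def by blast
  moreover from this assms(2) have "rooted_iso v J L (pmap_comp \<chi> \<phi>)" by (intro rooted_iso_comp)
  ultimately show ?thesis unfolding embeds_in_Dom_def by blast
qed

text \<open>Restrict the embedding of the larger subgraph; its image is connected and induced in
  \<open>L\<close>, hence in the domain of \<open>a\<close>.\<close>

lemma embeds_in_Dom_induced:
  assumes fin: "finite_multigraph G" and a: "a \<in> Tisg G v"
    and X: "X \<in> rooted_sets G v" and emb: "embeds_in_Dom G v a (induced G X)"
    and W: "W \<in> rooted_sets G v" "W \<subseteq> X"
  shows "embeds_in_Dom G v a (induced G W)"
proof -
  obtain A B where A: "A \<in> rooted_sets G v" and "rooted_iso v (induced G A) (induced G B) a"
    using a Tisg_iff[OF fin] by blast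
  then have D: "Dom G a = induced G A" using Dom_eq_induced unfolding rooted_iso_def by blast
  obtain L \<chi> where L: "L \<in> rooted_sets (Dom G a) v"
    and \<chi>: "rooted_iso v (induced G X) (induced (Dom G a) L) \<chi>"
    using emb unfolding embeds_in_Dom_def rooted_connected_induced_iff by blast
  have LA: "L \<subseteq> verts (Dom G a)" using L by (simp add: rooted_sets_def)
  have finD: "finite_multigraph (Dom G a)"
    unfolding D by (rule finite_multigraph_induced[OF fin]) (use A in \<open>simp add: rooted_sets_def\<close>)
  have "finite_multigraph (induced (Dom G a) L)" by (rule finite_multigraph_induced[OF finD LA])
  moreover have "finite_multigraph (induced G X)"
    by (rule finite_multigraph_induced[OF fin]) (use X in \<open>simp add: rooted_sets_def\<close>)
  moreover have W': "W \<subseteq> verts (induced G X)" "v \<in> W" "connected (induced (induced G X) W)"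
    using W by (auto simp: rooted_sets_def induced_induced)
  ultimately obtain Z where Z: "Z \<subseteq> verts (induced (Dom G a) L)" "v \<in> Z"
      "connected (induced (induced (Dom G a) L) Z)"
    and r: "rooted_iso v (induced (induced G X) W) (induced (induced (Dom G a) L) Z)
      (pmap_restrict \<chi> (induced (induced G X) W))"
    using rooted_iso_restrict_dom[OF \<chi>] by metis
  have eq: "induced (induced (Dom G a) L) Z = induced (Dom G a) Z" "induced (induced G X) W = induced G W"
    using Z(1) W(2) by (simp_all add: induced_induced)
  have "Z \<in> rooted_sets (Dom G a) v" using Z LA by (auto simp: rooted_sets_def eq)
  with r show ?thesis
    unfolding embeds_in_Dom_def rooted_connected_induced_iff eq by blast
qed

lemma Tisg_ideal_iff:
  assumes "finite_multigraph G"
  shows "\<phi> \<in> Tisg_ideal G v a \<longleftrightarrow> (\<exists>X\<in>rooted_sets G v. \<exists>Y\<in>rooted_sets G v.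
    rooted_iso v (induced G X) (induced G Y) \<phi> \<and> embeds_in_Dom G v a (induced G X) \<and>
    embeds_in_Dom G v a (induced G Y))"
  unfolding Tisg_ideal_def mem_Collect_eq Tisg_iff[OF assms] rooted_connected_induced_iff rooted_iso_def
  by blast

text \<open>The disjunction treats left and right multiplication together.\<close>

lemma Tisg_ideal_comp:
  assumes fin: "finite_multigraph G" and a: "a \<in> Tisg G v"
    and \<phi>: "\<phi> \<in> Tisg G v" and \<psi>: "\<psi> \<in> Tisg G v"
    and or: "\<phi> \<in> Tisg_ideal G v a \<or> \<psi> \<in> Tisg_ideal G v a"
  shows "Tisg_comp G v \<psi> \<phi> \<in> Tisg_ideal G v a"
proof -
  obtain X Y X' Y' where XY: "X \<in> rooted_sets G v" "X' \<in> rooted_sets G v" "Y \<in> rooted_sets G v"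
      "Y' \<in> rooted_sets G v" "rooted_iso v (induced G X) (induced G Y) \<phi>"
      "rooted_iso v (induced G X') (induced G Y') \<psi>"
    and emb: "embeds_in_Dom G v a (induced G Y) \<or> embeds_in_Dom G v a (induced G X')"
    using or \<phi> \<psi> unfolding Tisg_ideal_iff[OF fin] Tisg_iff[OF fin] by blast
  from Tisg_comp_iso[OF fin XY] obtain W C Z \<phi>' \<psi>' where
    sets: "W \<in> rooted_sets G v" "C \<in> rooted_sets G v" "Z \<in> rooted_sets G v" and C: "C \<subseteq> Y \<inter> X'"
    and isos: "rooted_iso v (induced G W) (induced G C) \<phi>'" "rooted_iso v (induced G C) (induced G Z) \<psi>'"
    and eq: "Tisg_comp G v \<psi> \<phi> = pmap_comp \<psi>' \<phi>'" .
  \<comment> \<open>\<open>C\<close> lies in the image of \<open>\<phi>\<close> and in the domain of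
    \<open>\<psi>\<close>, and one of these embeds, whichever factor is in the ideal.\<close>
  have "embeds_in_Dom G v a (induced G C)"
    using emb embeds_in_Dom_induced[OF fin a _ _ sets(2)] XY C by blast
  then have "embeds_in_Dom G v a (induced G W)" "embeds_in_Dom G v a (induced G Z)"
    using embeds_in_Dom_iso[OF _ isos(1)] embeds_in_Dom_iso[OF _ rooted_iso_inv[OF isos(2)]] by auto
  then show ?thesis
    unfolding Tisg_ideal_iff[OF fin] eq using sets rooted_iso_comp[OF isos] by blast
qed

lemma generator_in_Tisg_ideal:
  assumes fin: "finite_multigraph G" and a: "a \<in> Tisg G v"
  shows "a \<in> Tisg_ideal G v a"
proof -
  obtain A B where AB: "A \<in> rooted_sets G v" "B \<in> rooted_sets G v"
    and iso: "rooted_iso v (induced G A) (induced G B) a"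
    using a Tisg_iff[OF fin] by blast
  then have D: "Dom G a = induced G A" using Dom_eq_induced unfolding rooted_iso_def by blast
  have "induced (induced G A) A = induced G A" by (simp add: induced_induced)
  then have "rooted_connected_induced (Dom G a) v (induced G A)"
    unfolding D rooted_connected_induced_def using AB by (intro exI[of _ A]) (auto simp: rooted_sets_def)
  \<comment> \<open>The embedding is the identity of the domain, obtained as \<open>a\<close>
    followed by its inverse.\<close>
  then have "embeds_in_Dom G v a (induced G A)"
    unfolding embeds_in_Dom_def using rooted_iso_comp[OF iso rooted_iso_inv[OF iso]] by blast
  moreover from this have "embeds_in_Dom G v a (induced G B)"
    by (rule embeds_in_Dom_iso[OF _ rooted_iso_inv[OF iso]])
  ultimately show ?thesis unfolding Tisg_ideal_iff[OF fin] using AB iso by blast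
qed

lemma Tisg_ideal_minimal:
  assumes fin: "finite_multigraph G"
    and I: "semigroup_ideal (Tisg G v) (Tisg_comp G v) I" and a: "a \<in> I"
  shows "Tisg_ideal G v a \<subseteq> I"
proof
  fix \<phi> assume "\<phi> \<in> Tisg_ideal G v a"
  then obtain X Y where XY: "X \<in> rooted_sets G v" "Y \<in> rooted_sets G v"
    and \<phi>: "rooted_iso v (induced G X) (induced G Y) \<phi>" and emb: "embeds_in_Dom G v a (induced G X)"
    unfolding Tisg_ideal_iff[OF fin] by blast
  have "a \<in> Tisg G v" using I a by (auto simp: semigroup_ideal_def)
  then obtain A B where AB: "A \<in> rooted_sets G v" "B \<in> rooted_sets G v"
    and iso: "rooted_iso v (induced G A) (induced G B) a"
    using Tisg_iff[OF fin] by blast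
  then have D: "Dom G a = induced G A" using Dom_eq_induced unfolding rooted_iso_def by blast
  obtain L \<chi> where L: "L \<in> rooted_sets (induced G A) v"
    and \<chi>: "rooted_iso v (induced G X) (induced (induced G A) L) \<chi>"
    using emb unfolding embeds_in_Dom_def rooted_connected_induced_iff D by blast
  then have LA: "L \<subseteq> A" "v \<in> L" "connected (induced (induced G A) L)" by (auto simp: rooted_sets_def)
  have ind: "induced (induced G A) L = induced G L" using LA by (simp add: induced_induced)
  have L': "L \<in> rooted_sets G v" using LA AB ind by (auto simp: rooted_sets_def)
  have fins: "finite_multigraph (induced G S)" if "S \<in> rooted_sets G v" for S
    using that finite_multigraph_induced[OF fin] by (auto simp: rooted_sets_def)
  \<comment> \<open>The image \<open>L\<close> of \<open>\<chi>\<close> lies in the domain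
    \<open>A\<close> of \<open>a\<close>.\<close>
  have full: "Tisg_comp G v a \<chi> = pmap_comp a \<chi>"
    by (rule Tisg_comp_full[of G L v A "induced G X" \<chi> "induced G B"])
      (use L' LA \<chi> iso ind in \<open>auto simp: rooted_iso_def rooted_sets_def\<close>)
  from rooted_iso_restrict_dom[OF iso fins[OF AB(1)] fins[OF AB(2)] _ LA(2,3)] LA(1)
  obtain Z where Z: "Z \<subseteq> B" "v \<in> Z" "connected (induced (induced G B) Z)"
    and r: "rooted_iso v (induced G L) (induced (induced G B) Z) (pmap_restrict a (induced G L))"
    by (auto simp: ind)
  have indZ: "induced (induced G B) Z = induced G Z" using Z by (simp add: induced_induced)
  have Z': "Z \<in> rooted_sets G v" using Z AB indZ by (auto simp: rooted_sets_def)
  define \<theta> where "\<theta> = pmap_comp a \<chi>"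
  have \<chi>L: "rooted_iso v (induced G X) (induced G L) \<chi>" using \<chi> ind by simp
  \<comment> \<open>After \<open>\<chi>\<close>, whose image is \<open>L\<close>, restricting
    \<open>a\<close> to \<open>L\<close> changes nothing. Hence the plain composite
    \<open>\<theta>\<close> is an isomorphism onto the image \<open>Z\<close> of \<open>L\<close>
    under \<open>a\<close>.\<close>
  have "(g |` V) \<circ>\<^sub>m f = g \<circ>\<^sub>m f" if "\<And>x y. f x = Some y \<Longrightarrow> y \<in> V"
    for f :: "'c \<rightharpoonup> 'd" and g :: "'d \<rightharpoonup> 'c" and V
    using that by (auto simp: fun_eq_iff restrict_map_def map_comp_def split: option.splits)
  moreover have "graph_iso (induced G X) (induced G L) \<chi>" using \<chi>L by (simp add: rooted_iso_def)
  ultimately have "pmap_comp (pmap_restrict a (induced G L)) \<chi> = \<theta>"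
    unfolding \<theta>_def pmap_comp_def pmap_restrict_def
    using graph_iso_vmap(2)[of _ "induced G L" \<chi>] graph_iso_emap(2)[of _ "induced G L" \<chi>]
    by (metis (no_types, lifting) graph_pmap.select_convs)
  with rooted_iso_comp[OF \<chi>L r] have \<theta>: "rooted_iso v (induced G X) (induced G Z) \<theta>"
    by (simp add: indZ)
  \<comment> \<open>Undoes \<open>\<theta>\<close> and then applies \<open>\<phi>\<close>; its
    domain is exactly the image of \<open>\<theta>\<close>, so the next product is again plain
    composition.\<close>
  define \<rho> where "\<rho> = pmap_comp \<phi> (pmap_inv \<theta>)"
  have \<rho>: "rooted_iso v (induced G Z) (induced G Y) \<rho>"
    unfolding \<rho>_def by (rule rooted_iso_comp[OF rooted_iso_inv[OF \<theta>] \<phi>])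
  have "Tisg_comp G v \<rho> \<theta> = pmap_comp \<rho> \<theta>"
    by (rule Tisg_comp_full[of G Z v Z "induced G X" \<theta> "induced G Y"])
      (use Z' \<theta> \<rho> in \<open>auto simp: rooted_iso_def rooted_sets_def\<close>)
  also have "\<dots> = \<phi>"
    unfolding \<rho>_def by (rule pmap_comp_inv_cancel) (use \<theta> \<phi> in \<open>auto simp: rooted_iso_def\<close>)
  finally have "Tisg_comp G v \<rho> (Tisg_comp G v a \<chi>) = \<phi>" by (simp add: full \<theta>_def)
  moreover have "\<rho> \<in> Tisg G v" "\<chi> \<in> Tisg G v"
    unfolding Tisg_iff[OF fin] using \<rho> \<chi>L XY Z' L' by blast+
  \<comment> \<open>Multiplying \<open>a\<close> by \<open>\<chi>\<close> on the right and then by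
    \<open>\<rho>\<close> on the left stays in \<open>I\<close>.\<close>
  ultimately show "\<phi> \<in> I" using I a unfolding semigroup_ideal_def by metis
qed

theorem theorem4p20:
  fixes G :: "('v, 'e) multigraph" and v :: 'v and a :: "('v, 'e) graph_pmap"
  assumes "finite_multigraph G"
    and "v \<in> verts G"
    and "a \<in> Tisg G v"
  shows "semigroup_ideal (Tisg G v) (Tisg_comp G v) (Tisg_ideal G v a)
    \<and> a \<in> Tisg_ideal G v a
    \<and> (\<forall>I. semigroup_ideal (Tisg G v) (Tisg_comp G v) I \<and> a \<in> I \<longrightarrow> Tisg_ideal G v a \<subseteq> I)"
proof (intro conjI allI impI)
  have "Tisg_ideal G v a \<subseteq> Tisg G v" by (auto simp: Tisg_ideal_def)
  then show "semigroup_ideal (Tisg G v) (Tisg_comp G v) (Tisg_ideal G v a)"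
    unfolding semigroup_ideal_def using Tisg_ideal_comp[OF assms(1,3)] by blast
  show "a \<in> Tisg_ideal G v a" by (rule generator_in_Tisg_ideal[OF assms(1,3)])
  show "Tisg_ideal G v a \<subseteq> I"
    if "semigroup_ideal (Tisg G v) (Tisg_comp G v) I \<and> a \<in> I" for I
    using that Tisg_ideal_minimal[OF assms(1)] by blast
qed

end
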